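(* Let $m,n,r\in\mathbb{N}$, let $\mathcal{I}\subseteq\mathbb{R}$ be an interval with $0\in\mathcal{I}$, let $c_1,\ldots,c_r\in\mathbb{R}$ be scalars, let $H_k(t)=H_k(t)^*$ $(1\le k\le r,\ t\in\mathcal{I})$ be $m\times m$ matrix functions, and let $A,S(0)\in\mathbb{C}^{n\times n}$ and $\Pi(0)\in\mathbb{C}^{n\times m}$ be matrices. Assume that $$AS(0)-S(0)A^*=\mathrm{i}\,\Pi(0)\Pi(0)^*,\qquad S(0)=S(0)^*,$$ that $c_k\notin\sigma(A)$ for $1\le k\le r$, and that $c_i\neq c_k$ for $i\ne k$. Assume further that the matrix functions $\Pi(t)$ ($n\times m$) and $S(t)$ ($n\times n$), with values $\Pi(0)$ and $S(0)$ at $t=0$, satisfy on $\mathcal{I}$ the equations $$\Pi'(t)=-\mathrm{i}\sum_{k=1}^r(A-c_kI_n)^{-1}\Pi(t)H_k(t),$$ $$S'(t)=-\sum_{k=1}^r(A-c_kI_n)^{-1}\Pi(t)H_k(t)\Pi(t)^*(A^*-c_kI_n)^{-1}.$$ Then, in the points $t$ of invertibility of $S(t)$, the $m\times n$ matrix function $$\widetilde\psi(t,\zeta_1,\ldots,\zeta_r)=\Pi(t)^*S(t)^{-1}\exp\Big\{\mathrm{i}\sum_{k=1}^r\zeta_k(A-c_kI_n)^{-1}\Big\}$$ satisfies the transformed dynamical system $$\frac{\partial\widetilde\psi}{\partial t}=\sum_{k=1}^r\widetilde H_k(t)\frac{\partial\widetilde\psi}{\partial\zeta_k},\qquad \widetilde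 H_k(t)=\widetilde H_k(t)^*=w_A(t,c_k)H_k(t)w_A(t,c_k)^*,$$ where $$w_A(t,z)=I_m-\mathrm{i}\,\Pi(t)^*S(t)^{-1}(A-zI_n)^{-1}\Pi(t).$$
   Context: $\mathrm{i}$ is the imaginary unit, $M^*$ denotes the conjugate transpose of a matrix $M$, $\sigma(A)$ is the spectrum of $A$, $I_n$ is the $n\times n$ identity matrix, and $'$ denotes $\frac{d}{dt}$. The variables $\zeta_1,\ldots,\zeta_r$ are real space variables. *)

theory Defs
  imports "HOL-Analysis.Analysis"
begin

text \<open>
  A \<open>p \<times> q\<close> complex matrix has type \<^typ>\<open>complex^'q^'p\<close>. The scalar matrix \<open>z I\<close> is
  \<^term>\<open>mat z\<close>.
\<close>

definition conj_transpose :: "complex^'q^'p \<Rightarrow> complex^'p^'q" where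
  "conj_transpose M = map_matrix cnj (transpose M)"

text \<open>Multiplication of a matrix by a scalar; the library operator \<open>*s\<close> does not apply, since the
  entries of a matrix, seen as a vector, are its rows.\<close>

definition cscale :: "complex \<Rightarrow> complex^'q^'p \<Rightarrow> complex^'q^'p"  (infixr \<open>*\<^sub>C\<close> 75) where
  "z *\<^sub>C M = map_matrix (\<lambda>x. z * x) M"

definition spectrum :: "complex^'n^'n \<Rightarrow> complex set" where
  "spectrum A = {z. \<not> invertible (A - mat z)}"

definition resolvent :: "complex^'n^'n \<Rightarrow> real \<Rightarrow> complex^'n^'n" where
  "resolvent A x = matrix_inv (A - mat (of_real x))"

primrec mat_power :: "complex^'n^'n \<Rightarrow> nat \<Rightarrow> complex^'n^'n" where
  "mat_power M 0 = mat 1"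
| "mat_power M (Suc k) = M ** mat_power M k"

text \<open>The library function \<^const>\<open>exp\<close> is not available here: multiplication on the type \<open>_^_\<close> is
  componentwise, so square matrices are not an instance of the required algebra class.\<close>

definition mat_exp :: "complex^'n^'n \<Rightarrow> complex^'n^'n" where
  "mat_exp M = (\<Sum>k. (1 / fact k) *\<^sub>R mat_power M k)"

text \<open>In the following, \<open>P\<close> stands for \<open>\<Pi>\<close>.\<close>

definition transfer_fun ::
  "complex^'n^'n \<Rightarrow> (real \<Rightarrow> complex^'m^'n) \<Rightarrow> (real \<Rightarrow> complex^'n^'n) \<Rightarrow> real \<Rightarrow> complex
    \<Rightarrow> complex^'m^'m" where
  "transfer_fun A P S t z =
     mat 1 - \<i> *\<^sub>C (conj_transpose (P t) ** matrix_inv (S t) ** matrix_inv (A - mat z) ** P t)"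

text \<open>Only the values \<open>\<zeta> 1, \<dots>, \<zeta> r\<close> of the function \<open>\<zeta>\<close> matter.\<close>

definition transformed_psi ::
  "complex^'n^'n \<Rightarrow> nat \<Rightarrow> (nat \<Rightarrow> real) \<Rightarrow> (real \<Rightarrow> complex^'m^'n) \<Rightarrow> (real \<Rightarrow> complex^'n^'n)
    \<Rightarrow> real \<Rightarrow> (nat \<Rightarrow> real) \<Rightarrow> complex^'n^'m" where
  "transformed_psi A r c P S t \<zeta> =
     conj_transpose (P t) ** matrix_inv (S t)
       ** mat_exp (\<i> *\<^sub>C (\<Sum>k=1..r. \<zeta> k *\<^sub>R resolvent A (c k)))"

definition transformed_H ::
  "complex^'n^'n \<Rightarrow> (nat \<Rightarrow> real) \<Rightarrow> (nat \<Rightarrow> real \<Rightarrow> complex^'m^'m) \<Rightarrow> (real \<Rightarrow> complex^'m^'n)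
    \<Rightarrow> (real \<Rightarrow> complex^'n^'n) \<Rightarrow> nat \<Rightarrow> real \<Rightarrow> complex^'m^'m" where
  "transformed_H A c H P S k t =
     transfer_fun A P S t (of_real (c k)) ** H k t
       ** conj_transpose (transfer_fun A P S t (of_real (c k)))"

end

theory Submission
  imports Defs
begin

text \<open>
  Write \<open>\<Pi>\<close> for \<open>P\<close>, \<open>R\<^sub>k = (A - c\<^sub>k)\<inverse>\<close>, \<open>w\<^sub>k = w\<^sub>A(t, c\<^sub>k)\<close>, and a star for the conjugate transpose.

  The two differential equations are made for each other so that two properties of the initial data
  survive for all times: \<open>S = S*\<close>, because \<open>S'\<close> is self-adjoint, and the operator identity
  \<open>A S - S A* = \<i> \<Pi> \<Pi>*\<close>, because both sides have the derivative
  \<open>\<Sum>k. (R\<^sub>k \<Pi> H\<^sub>k \<Pi>* - \<Pi> H\<^sub>k \<Pi>* R\<^sub>k*)\<close>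
  (lemmas \<open>self_adjoint_invariant\<close> and \<open>operator_identity_invariant\<close>).

  Differentiating \<open>\<Pi>* S\<inverse>\<close> by the product rule and collecting terms gives
  \<open>(\<Pi>* S\<inverse>)' = \<i> \<Sum>k. w\<^sub>k H\<^sub>k \<Pi>* R\<^sub>k* S\<inverse>\<close>. The resolvents of \<open>A*\<close> stand here on the wrong side of \<open>S\<inverse>\<close>.
  The operator identity moves them across at the price of a second factor \<open>w\<^sub>k*\<close>:
  \<open>\<Pi>* R\<^sub>k* S\<inverse> = w\<^sub>k* \<Pi>* S\<inverse> R\<^sub>k\<close> (lemma \<open>transfer_fun_intertwining\<close>). So
  \<open>(\<Pi>* S\<inverse>)' = \<Sum>k. w\<^sub>k H\<^sub>k w\<^sub>k* \<Pi>* S\<inverse> (\<i> R\<^sub>k)\<close>.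

  Multiplication by the exponential on the right turns the left-hand side into the time derivative of
  the transformed function. Since the resolvents commute, \<open>\<partial>/\<partial>\<zeta>\<^sub>k\<close> multiplies the exponential by \<open>\<i> R\<^sub>k\<close>,
  so the \<open>k\<close>-th summand becomes \<open>w\<^sub>k H\<^sub>k w\<^sub>k*\<close> times the derivative with respect to \<open>\<zeta>\<^sub>k\<close>.

  The analytic ingredients are the derivatives of a matrix inverse and of a matrix exponential along a
  line of commuting matrices.
\<close>

section \<open>Matrix algebra\<close>

text \<open>Supplies distributivity, the product rule and submultiplicativity up to a constant, for matrices
  of any compatible shapes.\<close>

interpretation matrix_mult: bounded_bilinear
  "(**) :: complex^'b^'a \<Rightarrow> complex^'c^'b \<Rightarrow> complex^'c^'a"
  unfolding bilinear_conv_bounded_bilinear[symmetric] bilinear_def linear_iff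
  by (simp add: vec_eq_iff matrix_matrix_mult_def sum.distrib algebra_simps scaleR_right.sum)

lemma bounded_linear_conj_transpose:
  "bounded_linear (conj_transpose :: complex^'b^'a \<Rightarrow> complex^'a^'b)"
  unfolding linear_conv_bounded_linear[symmetric] linear_iff
  by (simp add: vec_eq_iff conj_transpose_def transpose_def)

lemma bounded_linear_cscale: "bounded_linear (cscale z :: complex^'b^'a \<Rightarrow> complex^'b^'a)"
  unfolding linear_conv_bounded_linear[symmetric] linear_iff
  by (simp add: vec_eq_iff cscale_def algebra_simps)

lemmas conj_transpose_linear_simps =
  bounded_linear_conj_transpose[THEN bounded_linear.linear, THEN linear_add]
  bounded_linear_conj_transpose[THEN bounded_linear.linear, THEN linear_diff]
  bounded_linear_conj_transpose[THEN bounded_linear.linear, THEN linear_neg]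
  bounded_linear_conj_transpose[THEN bounded_linear.linear, THEN linear_sum]

lemmas cscale_linear_simps =
  bounded_linear_cscale[THEN bounded_linear.linear, THEN linear_add]
  bounded_linear_cscale[THEN bounded_linear.linear, THEN linear_diff]
  bounded_linear_cscale[THEN bounded_linear.linear, THEN linear_neg]
  bounded_linear_cscale[THEN bounded_linear.linear, THEN linear_sum]
  bounded_linear_cscale[THEN bounded_linear.linear, THEN linear_scale]

lemma conj_transpose_nth: "conj_transpose M $ i $ j = cnj (M $ j $ i)"
  by (simp add: conj_transpose_def transpose_def)

lemma conj_transpose_conj_transpose [simp]: "conj_transpose (conj_transpose M) = M"
  by (simp add: vec_eq_iff conj_transpose_nth)

lemma conj_transpose_mult:
  "conj_transpose (M ** N) = conj_transpose N ** conj_transpose M"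
  for M :: "complex^'b^'a" and N :: "complex^'c^'b"
  by (simp add: vec_eq_iff conj_transpose_nth matrix_matrix_mult_def mult.commute)

lemma conj_transpose_cscale [simp]: "conj_transpose (z *\<^sub>C M) = cnj z *\<^sub>C conj_transpose M"
  by (simp add: vec_eq_iff conj_transpose_nth cscale_def)

lemma conj_transpose_mat [simp]: "conj_transpose (mat z) = mat (cnj z)"
  by (simp add: vec_eq_iff conj_transpose_nth mat_def)

lemma cscale_mult_left: "(z *\<^sub>C M) ** N = z *\<^sub>C (M ** N)"
  for M :: "complex^'b^'a" and N :: "complex^'c^'b"
  by (simp add: vec_eq_iff cscale_def matrix_matrix_mult_def sum_distrib_left mult.assoc)

lemma cscale_mult_right: "M ** (z *\<^sub>C N) = z *\<^sub>C (M ** N)"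
  for M :: "complex^'b^'a" and N :: "complex^'c^'b"
  by (simp add: vec_eq_iff cscale_def matrix_matrix_mult_def sum_distrib_left mult.left_commute)

lemma cscale_cscale [simp]: "z *\<^sub>C w *\<^sub>C M = (z * w) *\<^sub>C M"
  by (simp add: vec_eq_iff cscale_def mult.assoc)

lemma cscale_one [simp]: "1 *\<^sub>C M = M" "(-1) *\<^sub>C M = - M"
  by (simp_all add: vec_eq_iff cscale_def)

lemma mat_mult_commute: "mat z ** M = M ** mat z" for M :: "complex^'a^'a"
  by (simp add: vec_eq_iff mat_def matrix_matrix_mult_def if_distrib if_distribR mult.commute
      cong: if_cong)

lemma matrix_inv_mult:
  assumes "invertible M"
  shows "M ** matrix_inv M = mat 1" "matrix_inv M ** M = mat 1"
proof -
  have "M ** matrix_inv M = mat 1 \<and> matrix_inv M ** M = mat 1"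
    using assms unfolding invertible_def matrix_inv_def by (rule someI_ex)
  then show "M ** matrix_inv M = mat 1" "matrix_inv M ** M = mat 1" by auto
qed

lemma matrix_inv_eqI:
  fixes M N :: "complex^'a^'a"
  assumes "M ** N = mat 1"
  shows "matrix_inv M = N"
proof -
  have "invertible M" using assms invertible_right_inverse by blast
  then have "matrix_inv M ** (M ** N) = N"
    by (simp add: matrix_mul_assoc matrix_inv_mult)
  then show ?thesis by (simp add: assms)
qed

lemma conj_transpose_matrix_inv:
  fixes M :: "complex^'a^'a"
  assumes "invertible M"
  shows "conj_transpose (matrix_inv M) = matrix_inv (conj_transpose M)"
proof -
  have "conj_transpose M ** conj_transpose (matrix_inv M) = mat 1"
    by (simp add: conj_transpose_mult[symmetric] matrix_inv_mult[OF assms])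
  then show ?thesis by (simp add: matrix_inv_eqI)
qed

section \<open>Derivative of the inverse\<close>

text \<open>Difference quotients make algebraic identities between increments, such as
  \<open>N\<inverse> - M\<inverse> = - N\<inverse> (N - M) M\<inverse>\<close>, directly usable for derivatives.\<close>

lemma has_vector_derivative_iff_slope:
  "(f has_vector_derivative D) (at x within s) \<longleftrightarrow>
     ((\<lambda>y. (f y - f x) /\<^sub>R (y - x)) \<longlongrightarrow> D) (at x within s)"
proof -
  have "(f has_vector_derivative D) (at x within s) \<longleftrightarrow>
      ((\<lambda>y. norm ((1 / norm (y - x)) *\<^sub>R (f y - (f x + (y - x) *\<^sub>R D)))) \<longlongrightarrow> 0) (at x within s)"
    unfolding has_vector_derivative_def has_derivative_within tendsto_norm_zero_iff
    using bounded_linear_scaleR_left by blast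
  also have "\<dots> \<longleftrightarrow> ((\<lambda>y. norm ((f y - f x) /\<^sub>R (y - x) - D)) \<longlongrightarrow> 0) (at x within s)"
  proof (rule filterlim_cong[OF refl refl])
    have *: "norm ((1 / norm (y - x)) *\<^sub>R (f y - (f x + (y - x) *\<^sub>R D))) =
        norm ((f y - f x) /\<^sub>R (y - x) - D)" if "y \<noteq> x" for y
    proof -
      have "(f y - f x) /\<^sub>R (y - x) - D = (f y - (f x + (y - x) *\<^sub>R D)) /\<^sub>R (y - x)"
        using that by (simp add: diff_diff_eq[symmetric] scaleR_diff_right[of _ "f y - f x"])
      then show ?thesis by (simp add: divide_inverse)
    qed
    show "\<forall>\<^sub>F y in at x within s. norm ((1 / norm (y - x)) *\<^sub>R (f y - (f x + (y - x) *\<^sub>R D))) =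
        norm ((f y - f x) /\<^sub>R (y - x) - D)"
      unfolding eventually_at_filter using * by (intro always_eventually) blast
  qed
  also have "\<dots> \<longleftrightarrow> ((\<lambda>y. (f y - f x) /\<^sub>R (y - x)) \<longlongrightarrow> D) (at x within s)"
    by (simp add: tendsto_norm_zero_iff LIM_zero_iff)
  finally show ?thesis .
qed

lemma tendsto_det:
  fixes M :: "'b \<Rightarrow> complex^'a^'a"
  assumes "\<And>i j. ((\<lambda>y. M y $ i $ j) \<longlongrightarrow> L $ i $ j) F"
  shows "((\<lambda>y. det (M y)) \<longlongrightarrow> det L) F"
  unfolding det_def by (intro tendsto_intros assms)

text \<open>Cramer's rule shows that the inverse depends continuously on the matrix.\<close>

lemma matrix_inv_cramer:
  fixes M :: "complex^'a^'a"
  assumes "invertible M"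
  shows "matrix_inv M $ k $ l =
    det (\<chi> i j. if j = k then (mat 1 :: complex^'a^'a) $ i $ l else M $ i $ j) / det M"
proof -
  have d: "det M \<noteq> 0" using assms invertible_det_nz by blast
  have "M *v column l (matrix_inv M) = column l (mat 1)"
    by (subst matrix_inv_mult(1)[OF assms, symmetric])
      (simp add: vec_eq_iff column_def matrix_vector_mult_def matrix_matrix_mult_def)
  then have "column l (matrix_inv M) $ k =
      (\<chi> k. det (\<chi> i j. if j = k then column l (mat 1) $ i else M $ i $ j) / det M) $ k"
    unfolding cramer[OF d] by (rule arg_cong)
  then show ?thesis by (simp add: column_def cong: if_cong)
qed

lemma tendsto_matrix_inv:
  fixes M :: "'b \<Rightarrow> complex^'a^'a"
  assumes lim: "(M \<longlongrightarrow> L) F" and inv: "invertible L"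
  shows "\<forall>\<^sub>F y in F. invertible (M y)"
    and "((\<lambda>y. matrix_inv (M y)) \<longlongrightarrow> matrix_inv L) F"
proof -
  have ent: "((\<lambda>y. M y $ i $ j) \<longlongrightarrow> L $ i $ j) F" for i j
    by (intro tendsto_intros lim)
  have d: "det L \<noteq> 0" using inv invertible_det_nz by blast
  have "\<forall>\<^sub>F y in F. det (M y) \<noteq> 0"
    using tendsto_imp_eventually_ne[OF tendsto_det[OF ent] d] .
  then show ev: "\<forall>\<^sub>F y in F. invertible (M y)"
    by (simp add: invertible_det_nz)
  show "((\<lambda>y. matrix_inv (M y)) \<longlongrightarrow> matrix_inv L) F"
  proof (intro vec_tendstoI)
    fix k l
    let ?c = "\<lambda>M :: complex^'a^'a. \<chi> i j. if j = k then (mat 1 :: complex^'a^'a) $ i $ l else M $ i $ j"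
    have "((\<lambda>y. det (?c (M y)) / det (M y)) \<longlongrightarrow> det (?c L) / det L) F"
      by (intro tendsto_divide tendsto_det ent d) (auto intro: ent)
    then show "((\<lambda>y. matrix_inv (M y) $ k $ l) \<longlongrightarrow> matrix_inv L $ k $ l) F"
      unfolding matrix_inv_cramer[OF inv]
      by (rule Lim_transform_eventually) (use ev in eventually_elim, simp add: matrix_inv_cramer)
  qed
qed

text \<open>Divide \<open>S(y)\<inverse> - S(t)\<inverse> = - S(y)\<inverse> (S(y) - S(t)) S(t)\<inverse>\<close> by \<open>y - t\<close> and let \<open>y\<close> tend to \<open>t\<close>; the
  factor \<open>S(y)\<inverse>\<close> converges by continuity of the inverse.\<close>

lemma has_vector_derivative_matrix_inv:
  fixes S :: "real \<Rightarrow> complex^'a^'a"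
  assumes der: "(S has_vector_derivative D) (at t within I)" and inv: "invertible (S t)"
  shows "((\<lambda>\<tau>. matrix_inv (S \<tau>)) has_vector_derivative
            - (matrix_inv (S t) ** D ** matrix_inv (S t))) (at t within I)"
proof -
  let ?T = "\<lambda>\<tau>. matrix_inv (S \<tau>)"
  have lim: "(S \<longlongrightarrow> S t) (at t within I)"
    using has_vector_derivative_continuous[OF der] by (simp add: continuous_within)
  note T = tendsto_matrix_inv[OF lim inv]
  have "((\<lambda>y. - (?T y ** ((S y - S t) /\<^sub>R (y - t)) ** ?T t)) \<longlongrightarrow> - (?T t ** D ** ?T t))
      (at t within I)"
    using der unfolding has_vector_derivative_iff_slope
    by (intro tendsto_minus matrix_mult.tendsto T(2) tendsto_const)
  moreover have "\<forall>\<^sub>F y in at t within I.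
      - (?T y ** ((S y - S t) /\<^sub>R (y - t)) ** ?T t) = (?T y - ?T t) /\<^sub>R (y - t)"
    using T(1)
  proof eventually_elim
    case (elim y)
    have "?T y ** (S y - S t) ** ?T t = (?T y ** S y) ** ?T t - ?T y ** (S t ** ?T t)"
      by (simp add: matrix_mult.diff_left matrix_mult.diff_right matrix_mul_assoc)
    then have "?T y ** (S y - S t) ** ?T t = ?T t - ?T y"
      by (simp add: matrix_inv_mult elim inv)
    then have "- (?T y ** (S y - S t) ** ?T t) = ?T y - ?T t"
      by simp
    then show ?case
      unfolding matrix_mult.scaleR_left matrix_mult.scaleR_right scaleR_minus_right[symmetric]
      by simp
  qed
  ultimately show ?thesis
    unfolding has_vector_derivative_iff_slope by (rule Lim_transform_eventually)
qed

section \<open>Derivative of the exponential\<close>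

text \<open>Commutativity lets the inner derivative \<open>C\<close> be collected on the left in all \<open>k\<close> terms of the
  product rule. For \<open>k = 0\<close> the truncated exponent \<open>k - 1\<close> is harmless, as the factor \<open>k\<close> vanishes.\<close>

lemma has_vector_derivative_mat_power:
  fixes B C :: "complex^'a^'a"
  assumes comm: "B ** C = C ** B"
  shows "((\<lambda>x. mat_power (B + x *\<^sub>R C) k) has_vector_derivative
            real k *\<^sub>R (C ** mat_power (B + x *\<^sub>R C) (k - 1))) (at x within X)"
proof (induction k)
  case (Suc k)
  let ?M = "\<lambda>x. B + x *\<^sub>R C"
  have MC: "?M x ** C = C ** ?M x"
    by (simp add: matrix_mult.add_left matrix_mult.add_right matrix_mult.scaleR_left
        matrix_mult.scaleR_right comm)
  have M: "(?M has_vector_derivative C) (at x within X)"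
    by (auto intro!: derivative_eq_intros)
  have "?M x ** (real k *\<^sub>R (C ** mat_power (?M x) (k - 1))) = real k *\<^sub>R (C ** mat_power (?M x) k)"
  proof (cases k)
    case (Suc j)
    then show ?thesis
      by (simp add: matrix_mult.scaleR_right matrix_mul_assoc MC)
  qed simp
  then have "?M x ** (real k *\<^sub>R (C ** mat_power (?M x) (k - 1))) + C ** mat_power (?M x) k
      = real (Suc k) *\<^sub>R (C ** mat_power (?M x) (Suc k - 1))"
    by (simp add: algebra_simps)
  then show ?case
    using matrix_mult.has_vector_derivative[OF M Suc.IH] by simp
qed simp

text \<open>The norm is the Euclidean norm of the vector of entries, for which the identity need not have norm 1;
  the constant \<open>K\<close> is whatever bound the bilinearity of the product provides.\<close>

lemma norm_mat_power_le:
  fixes M :: "complex^'a^'a"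
  assumes K: "K > 0" "\<And>(L :: complex^'a^'a) (N :: complex^'a^'a). norm (L ** N) \<le> norm L * norm N * K"
  shows "norm (mat_power M k) \<le> norm (mat 1 :: complex^'a^'a) * (K * norm M) ^ k"
proof (induction k)
  case (Suc k)
  have "norm (mat_power M (Suc k)) \<le> norm M * norm (mat_power M k) * K"
    unfolding mat_power.simps by (rule K(2))
  also have "\<dots> \<le> norm M * (norm (mat 1 :: complex^'a^'a) * (K * norm M) ^ k) * K"
    using Suc K(1) by (intro mult_right_mono mult_left_mono) auto
  finally show ?case by (simp add: algebra_simps)
qed simp

lemma mat_exp_sums: "(\<lambda>k. (1 / fact k) *\<^sub>R mat_power M k) sums mat_exp M"
  for M :: "complex^'a^'a"
proof -
  obtain K where "K > 0"
    "\<And>(L :: complex^'a^'a) (N :: complex^'a^'a). norm (L ** N) \<le> norm L * norm N * K"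
    using matrix_mult.pos_bounded by blast
  note pow_le = norm_mat_power_le[OF this]
  have "summable (\<lambda>k. norm (mat 1 :: complex^'a^'a) * (inverse (fact k) * (K * norm M) ^ k))"
    by (intro summable_mult summable_exp)
  moreover have "norm ((1 / fact k) *\<^sub>R mat_power M k)
      \<le> norm (mat 1 :: complex^'a^'a) * (inverse (fact k) * (K * norm M) ^ k)" for k
    using mult_left_mono[OF pow_le[of M k], of "inverse (fact k)"]
    by (simp add: divide_inverse mult_ac)
  ultimately have "summable (\<lambda>k. (1 / fact k) *\<^sub>R mat_power M k)"
    by (rule summable_comparison_test'[where N = 0])
  then show ?thesis unfolding mat_exp_def by (rule summable_sums)
qed

text \<open>The series is differentiated term by term. On the interval of radius 1 around \<open>x\<close> the differentiated series
  is dominated by a scalar exponential series, and up to a shift of the index it is \<open>C\<close> times the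
  exponential series itself.\<close>

lemma has_vector_derivative_mat_exp:
  fixes B C :: "complex^'a^'a"
  assumes comm: "B ** C = C ** B"
  shows "((\<lambda>x. mat_exp (B + x *\<^sub>R C)) has_vector_derivative C ** mat_exp (B + x *\<^sub>R C)) (at x)"
proof -
  let ?M = "\<lambda>x. B + x *\<^sub>R C"
  define f where "f k y = (1 / fact k) *\<^sub>R mat_power (?M y) k" for k y
  define d where "d k y = (1 / fact k) *\<^sub>R (real k *\<^sub>R (C ** mat_power (?M y) (k - 1)))" for k y
  define X where "X = ball x 1"
  \<comment> \<open>a bound for the norm of \<open>?M y\<close> on \<open>X\<close>\<close>
  define \<rho> where "\<rho> = norm B + (\<bar>x\<bar> + 1) * norm C"
  obtain K where K: "K > 0"
    "\<And>(L :: complex^'a^'a) (N :: complex^'a^'a). norm (L ** N) \<le> norm L * norm N * K"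
    using matrix_mult.pos_bounded by blast
  define b where "b k = norm C * (norm (mat 1 :: complex^'a^'a) * (inverse (fact k) * (K * \<rho>) ^ k)) * K" for k
  have M_le: "norm (?M y) \<le> \<rho>" if "y \<in> X" for y
  proof -
    have "\<bar>y\<bar> \<le> \<bar>x\<bar> + 1" using that by (auto simp: X_def dist_real_def)
    then have "norm (y *\<^sub>R C) \<le> (\<bar>x\<bar> + 1) * norm C" by (simp add: mult_right_mono)
    then show ?thesis unfolding \<rho>_def by (intro norm_triangle_le) auto
  qed
  have d_Suc: "d (Suc k) y = C ** f k y" for k y
    by (simp add: d_def f_def matrix_mult.scaleR_right field_simps del: of_nat_Suc)
  have d_le: "norm (d (Suc k) y) \<le> b k" if "y \<in> X" for k y
  proof -
    have "norm (mat_power (?M y) k) \<le> norm (mat 1 :: complex^'a^'a) * (K * norm (?M y)) ^ k"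
      by (rule norm_mat_power_le[OF K])
    also have "\<dots> \<le> norm (mat 1 :: complex^'a^'a) * (K * \<rho>) ^ k"
      using K(1) M_le[OF that] by (intro mult_left_mono power_mono) auto
    finally have "norm (f k y) \<le> norm (mat 1 :: complex^'a^'a) * (inverse (fact k) * (K * \<rho>) ^ k)"
      by (simp add: f_def field_simps)
    then have "norm C * norm (f k y) * K \<le> b k"
      unfolding b_def using K(1) by (intro mult_right_mono mult_left_mono) auto
    then show ?thesis unfolding d_Suc using K(2) order_trans by blast
  qed
  have d_sums: "(\<lambda>k. d k y) sums (C ** mat_exp (?M y))" for y
  proof -
    have "(\<lambda>k. d (Suc k) y) sums (C ** mat_exp (?M y))"
      unfolding d_Suc f_def by (intro matrix_mult.bounded_linear_right[THEN bounded_linear.sums] mat_exp_sums)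
    then show ?thesis by (subst (asm) sums_Suc_iff) (simp add: d_def)
  qed
  have unif: "uniform_limit X (\<lambda>n y. \<Sum>k<n. d k y) (\<lambda>y. C ** mat_exp (?M y)) sequentially"
  proof -
    have "uniform_limit X (\<lambda>n y. \<Sum>k<n. d k y) (\<lambda>y. \<Sum>k. d k y) sequentially"
    proof (rule Weierstrass_m_test)
      show "norm (d k y) \<le> (case k of 0 \<Rightarrow> 0 | Suc j \<Rightarrow> b j)" if "y \<in> X" for k y
        using d_le[OF that] by (cases k) (simp_all add: d_def)
      have "summable b" unfolding b_def by (intro summable_mult summable_mult2 summable_exp)
      then show "summable (\<lambda>k. case k of 0 \<Rightarrow> 0 | Suc j \<Rightarrow> b j)"
        by (subst summable_Suc_iff[symmetric]) simp
    qed
    then show ?thesis by (simp add: sums_unique[OF d_sums, symmetric])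
  qed
  have "\<exists>g. \<forall>y\<in>X. (\<lambda>k. f k y) sums g y \<and>
      (g has_derivative (\<lambda>h. h *\<^sub>R (C ** mat_exp (?M y)))) (at y within X)"
  proof (rule has_derivative_series[where f' = "\<lambda>k y h. h *\<^sub>R d k y" and x = x])
    show "convex X" "x \<in> X" by (simp_all add: X_def)
    show "(\<lambda>k. f k x) sums mat_exp (?M x)" unfolding f_def by (rule mat_exp_sums)
    show "(f k has_derivative (\<lambda>h. h *\<^sub>R d k y)) (at y within X)" for k y
      unfolding f_def d_def has_vector_derivative_def[symmetric]
      by (intro bounded_linear.has_vector_derivative[OF bounded_linear_scaleR_right]
          has_vector_derivative_mat_power comm)
    fix e :: real assume "e > 0"
    then have "\<forall>\<^sub>F n in sequentially. \<forall>y\<in>X. norm ((\<Sum>k<n. d k y) - C ** mat_exp (?M y)) < e"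
      using unif unfolding uniform_limit_iff dist_norm by blast
    then show "\<forall>\<^sub>F n in sequentially. \<forall>y\<in>X. \<forall>h.
        norm ((\<Sum>k<n. h *\<^sub>R d k y) - h *\<^sub>R (C ** mat_exp (?M y))) \<le> e * norm h"
    proof eventually_elim
      case (elim n)
      show ?case
      proof (intro ballI allI)
        fix y h assume "y \<in> X"
        then have "\<bar>h\<bar> * norm ((\<Sum>k<n. d k y) - C ** mat_exp (?M y)) \<le> \<bar>h\<bar> * e"
          using elim by (intro mult_left_mono) (auto intro: less_imp_le)
        then show "norm ((\<Sum>k<n. h *\<^sub>R d k y) - h *\<^sub>R (C ** mat_exp (?M y))) \<le> e * norm h"
          by (simp add: scaleR_right.sum[symmetric] scaleR_diff_right[symmetric] mult.commute)
      qed
    qed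
  qed
  then obtain g where g: "\<And>y. y \<in> X \<Longrightarrow> (\<lambda>k. f k y) sums g y"
    "\<And>y. y \<in> X \<Longrightarrow> (g has_vector_derivative (C ** mat_exp (?M y))) (at y within X)"
    unfolding has_vector_derivative_def by blast
  have X: "open X" "x \<in> X" by (simp_all add: X_def)
  have eq: "g y = mat_exp (?M y)" if "y \<in> X" for y
    using g(1)[OF that] mat_exp_sums[of "?M y"] unfolding f_def by (rule sums_unique2)
  have "(g has_vector_derivative (C ** mat_exp (?M x))) (at x)"
    using g(2)[OF X(2)] has_vector_derivative_within_open[OF X(2,1)] by blast
  from this X eq show ?thesis
    by (rule has_vector_derivative_transform_within_open)
qed

section \<open>Resolvents\<close>

lemma resolvent_mult:
  assumes "complex_of_real x \<notin> spectrum A"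
  shows "(A - mat (of_real x)) ** resolvent A x = mat 1"
    and "resolvent A x ** (A - mat (of_real x)) = mat 1"
  using assms by (simp_all add: spectrum_def resolvent_def matrix_inv_mult)

lemma mult_resolvent:
  assumes "complex_of_real x \<notin> spectrum A"
  shows "A ** resolvent A x = mat 1 + mat (of_real x) ** resolvent A x"
  using resolvent_mult(1)[OF assms] by (simp add: matrix_mult.diff_left algebra_simps)

lemma conj_transpose_resolvent:
  assumes "complex_of_real x \<notin> spectrum A"
  shows "conj_transpose (resolvent A x) = resolvent (conj_transpose A) x"
  using assms
  by (simp add: spectrum_def resolvent_def conj_transpose_matrix_inv conj_transpose_linear_simps)

text \<open>Since \<open>A - x\<close> and \<open>A - y\<close> commute, multiply \<open>(A - x)(A - y) = (A - y)(A - x)\<close> by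
  \<open>(A - y)\<inverse> (A - x)\<inverse>\<close> on the left and by \<open>(A - x)\<inverse> (A - y)\<inverse>\<close> on the right.\<close>

lemma resolvent_commute:
  assumes x: "complex_of_real x \<notin> spectrum A" and y: "complex_of_real y \<notin> spectrum A"
  shows "resolvent A x ** resolvent A y = resolvent A y ** resolvent A x"
proof -
  let ?X = "A - mat (of_real x)" and ?Y = "A - mat (of_real y)"
  let ?R = "resolvent A x" and ?Q = "resolvent A y"
  have "?X ** ?Y = ?Y ** ?X"
    by (simp add: matrix_mult.diff_left matrix_mult.diff_right mat_mult_commute[of _ A]
        mat_mult_commute[of "of_real x" "mat (of_real y)"])
  then have "?Q ** ?R ** (?X ** ?Y) ** (?R ** ?Q) = ?Q ** ?R ** (?Y ** ?X) ** (?R ** ?Q)"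
    by simp
  moreover have "?Q ** ?R ** (?X ** ?Y) ** (?R ** ?Q) = ?Q ** ((?R ** ?X) ** ?Y) ** (?R ** ?Q)"
    by (simp add: matrix_mul_assoc)
  moreover have "\<dots> = ?R ** ?Q"
    by (simp add: resolvent_mult x y)
  moreover have "?Q ** ?R ** (?Y ** ?X) ** (?R ** ?Q) = ?Q ** ?R ** (?Y ** (?X ** ?R) ** ?Q)"
    by (simp add: matrix_mul_assoc)
  moreover have "\<dots> = ?Q ** ?R"
    by (simp add: resolvent_mult x y)
  ultimately show ?thesis by simp
qed

section \<open>Conserved quantities\<close>

text \<open>As \<open>A R\<^sub>k = 1 + c\<^sub>k R\<^sub>k\<close> and \<open>R\<^sub>k* A* = 1 + c\<^sub>k R\<^sub>k*\<close> with the same real \<open>c\<^sub>k\<close>, the derivative of \<open>A S - S A*\<close>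
  telescopes to \<open>\<Sum>k. (R\<^sub>k G\<^sub>k - G\<^sub>k R\<^sub>k*)\<close> with \<open>G\<^sub>k = P H\<^sub>k P*\<close>, and the product rule gives the same for
  \<open>\<i> P P*\<close>.\<close>

lemma operator_identity_invariant:
  fixes A :: "complex^'n^'n" and P :: "real \<Rightarrow> complex^'m^'n"
  assumes "is_interval I" "0 \<in> I" "t \<in> I"
    and H: "\<And>k t. k \<in> K \<Longrightarrow> t \<in> I \<Longrightarrow> conj_transpose (H k t) = H k t"
    and c: "\<And>k. k \<in> K \<Longrightarrow> complex_of_real (c k) \<notin> spectrum A"
    and P: "\<And>t. t \<in> I \<Longrightarrow>
      (P has_vector_derivative
         - (\<i> *\<^sub>C (\<Sum>k\<in>K. resolvent A (c k) ** P t ** H k t))) (at t within I)"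
    and S: "\<And>t. t \<in> I \<Longrightarrow>
      (S has_vector_derivative
         - (\<Sum>k\<in>K. resolvent A (c k) ** P t ** H k t ** conj_transpose (P t)
                        ** resolvent (conj_transpose A) (c k))) (at t within I)"
    and init: "A ** S 0 - S 0 ** conj_transpose A = \<i> *\<^sub>C (P 0 ** conj_transpose (P 0))"
  shows "A ** S t - S t ** conj_transpose A = \<i> *\<^sub>C (P t ** conj_transpose (P t))"
proof -
  let ?F = "\<lambda>t. A ** S t - S t ** conj_transpose A - \<i> *\<^sub>C (P t ** conj_transpose (P t))"
  have F0: "(?F has_vector_derivative 0) (at t within I)" if t: "t \<in> I" for t
  proof -
    define R where "R k = resolvent A (c k)" for k
    define Q where "Q k = resolvent (conj_transpose A) (c k)" for k
    define G where "G k = P t ** H k t ** conj_transpose (P t)" for k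
    have QR: "conj_transpose (R k) = Q k" if "k \<in> K" for k
      unfolding R_def Q_def by (rule conj_transpose_resolvent[OF c[OF that]])
    have AR: "A ** R k = mat 1 + mat (of_real (c k)) ** R k" if "k \<in> K" for k
      unfolding R_def by (rule mult_resolvent[OF c[OF that]])
    have QA: "Q k ** conj_transpose A = mat 1 + mat (of_real (c k)) ** Q k" if "k \<in> K" for k
      using arg_cong[OF AR[OF that], of conj_transpose]
      by (simp add: conj_transpose_mult conj_transpose_linear_simps QR[OF that] mat_mult_commute)
    have S': "(S has_vector_derivative - (\<Sum>k\<in>K. R k ** G k ** Q k)) (at t within I)"
      using S[OF t] by (simp add: R_def Q_def G_def matrix_mul_assoc)
    let ?P' = "- (\<i> *\<^sub>C (\<Sum>k\<in>K. R k ** P t ** H k t))"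
    have P': "(P has_vector_derivative ?P') (at t within I)"
      using P[OF t] by (simp add: R_def)
    have PP: "((\<lambda>t. P t ** conj_transpose (P t)) has_vector_derivative
        P t ** conj_transpose ?P' + ?P' ** conj_transpose (P t)) (at t within I)"
      by (intro matrix_mult.has_vector_derivative P'
          bounded_linear.has_vector_derivative[OF bounded_linear_conj_transpose])
    let ?X = "\<Sum>k\<in>K. R k ** G k ** Q k"
    have F': "(?F has_vector_derivative
        (A ** (- ?X) - (- ?X) ** conj_transpose A
          - \<i> *\<^sub>C (P t ** conj_transpose ?P' + ?P' ** conj_transpose (P t)))) (at t within I)"
      by (intro has_vector_derivative_diff
          bounded_linear.has_vector_derivative[OF bounded_linear_cscale] PP
          bounded_linear.has_vector_derivative[OF matrix_mult.bounded_linear_right]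
          bounded_linear.has_vector_derivative[OF matrix_mult.bounded_linear_left] S')
    have PP1: "\<i> *\<^sub>C (P t ** conj_transpose ?P') = - (\<Sum>k\<in>K. G k ** Q k)"
      by (simp add: conj_transpose_linear_simps conj_transpose_mult QR H t G_def
          cscale_linear_simps matrix_mult.minus_right matrix_mult.sum_right cscale_mult_right
          matrix_mul_assoc)
    have PP2: "\<i> *\<^sub>C (?P' ** conj_transpose (P t)) = (\<Sum>k\<in>K. R k ** G k)"
      by (simp add: G_def cscale_linear_simps matrix_mult.minus_left matrix_mult.sum_left
          cscale_mult_left matrix_mul_assoc sum_negf)
    have X: "A ** ?X - ?X ** conj_transpose A = (\<Sum>k\<in>K. G k ** Q k) - (\<Sum>k\<in>K. R k ** G k)"
    proof -
      have "A ** (R k ** G k ** Q k) - (R k ** G k ** Q k) ** conj_transpose A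
          = G k ** Q k - R k ** G k" if "k \<in> K" for k
      proof -
        have "A ** (R k ** G k ** Q k) - (R k ** G k ** Q k) ** conj_transpose A
            = (A ** R k) ** (G k ** Q k) - R k ** G k ** (Q k ** conj_transpose A)"
          by (simp add: matrix_mul_assoc)
        also have "\<dots> = G k ** Q k + mat (of_real (c k)) ** (R k ** G k ** Q k)
            - (R k ** G k + (R k ** G k ** mat (of_real (c k))) ** Q k)"
          unfolding AR[OF that] QA[OF that]
          by (simp add: matrix_mult.add_left matrix_mult.add_right matrix_mul_assoc)
        also have "\<dots> = G k ** Q k - R k ** G k"
          by (simp add: mat_mult_commute[symmetric] matrix_mul_assoc)
        finally show ?thesis .
      qed
      then show ?thesis
        by (simp add: matrix_mult.sum_left matrix_mult.sum_right flip: sum_subtractf)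
    qed
    have "A ** (- ?X) - (- ?X) ** conj_transpose A
        - \<i> *\<^sub>C (P t ** conj_transpose ?P' + ?P' ** conj_transpose (P t)) = 0"
      unfolding cscale_linear_simps(1) PP1 PP2
      unfolding matrix_mult.minus_left matrix_mult.minus_right
      using X by (simp add: algebra_simps)
    then show ?thesis using F' by (simp only:)
  qed
  obtain d where d: "\<And>t. t \<in> I \<Longrightarrow> ?F t = d"
    by (rule has_vector_derivative_zero_constant[OF is_interval_convex[OF assms(1)] F0]) (assumption, rule that)
  have "?F t = ?F 0"
    by (rule trans[OF d[OF assms(3)] d[OF assms(2), symmetric]])
  then show ?thesis using init by simp
qed

lemma self_adjoint_invariant:
  fixes S :: "real \<Rightarrow> complex^'n^'n"
  assumes "is_interval I" "0 \<in> I" "t \<in> I"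
    and S: "\<And>t. t \<in> I \<Longrightarrow> (S has_vector_derivative D t) (at t within I)"
    and D: "\<And>t. t \<in> I \<Longrightarrow> conj_transpose (D t) = D t"
    and init: "conj_transpose (S 0) = S 0"
  shows "conj_transpose (S t) = S t"
proof -
  have S0: "((\<lambda>t. conj_transpose (S t) - S t) has_vector_derivative 0) (at t within I)"
    if "t \<in> I" for t
    using has_vector_derivative_diff[OF bounded_linear.has_vector_derivative[OF
      bounded_linear_conj_transpose S[OF that]] S[OF that]] D[OF that] by simp
  obtain d where d: "\<And>t. t \<in> I \<Longrightarrow> conj_transpose (S t) - S t = d"
    by (rule has_vector_derivative_zero_constant[OF is_interval_convex[OF assms(1)] S0]) (assumption, rule that)
  have "conj_transpose (S t) - S t = conj_transpose (S 0) - S 0"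
    by (rule trans[OF d[OF assms(3)] d[OF assms(2), symmetric]])
  then show ?thesis using init by simp
qed

section \<open>The transformed system\<close>

text \<open>With \<open>R = (A - x)\<inverse>\<close>, write the operator identity as \<open>\<i> P P* = (A - x) S - S (A* - x)\<close>, which holds
  because \<open>x\<close> is real. Multiplying by \<open>R* S\<inverse>\<close> on the left and by \<open>S\<inverse> R\<close> on the right gives
  \<open>R* S\<inverse> (\<i> P P*) S\<inverse> R = R* S\<inverse> - S\<inverse> R\<close>, and multiplying by \<open>P*\<close> on the left yields the claim, because
  the adjoint of the transfer function at \<open>x\<close> is \<open>1 + \<i> P* R* S\<inverse> P\<close>.\<close>

lemma transfer_fun_intertwining:
  fixes A :: "complex^'n^'n" and P :: "real \<Rightarrow> complex^'m^'n"
  assumes x: "complex_of_real x \<notin> spectrum A"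
    and inv: "invertible (S t)"
    and sa: "conj_transpose (S t) = S t"
    and id: "A ** S t - S t ** conj_transpose A = \<i> *\<^sub>C (P t ** conj_transpose (P t))"
  shows "conj_transpose (transfer_fun A P S t (of_real x))
           ** (conj_transpose (P t) ** matrix_inv (S t) ** resolvent A x)
         = conj_transpose (P t) ** resolvent (conj_transpose A) x ** matrix_inv (S t)"
proof -
  let ?P = "P t" and ?P' = "conj_transpose (P t)" and ?T = "matrix_inv (S t)"
    and ?R = "resolvent A x" and ?Q = "resolvent (conj_transpose A) x"
    and ?X = "A - mat (of_real x)" and ?Y = "conj_transpose A - mat (of_real x)"
  have QR: "conj_transpose ?R = ?Q" by (rule conj_transpose_resolvent[OF x])
  have T: "conj_transpose ?T = ?T" using conj_transpose_matrix_inv[OF inv] by (simp add: sa)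
  have "conj_transpose (?X ** ?R) = mat 1"
    by (simp add: resolvent_mult[OF x])
  then have QY: "?Q ** ?Y = mat 1"
    by (simp add: conj_transpose_mult QR conj_transpose_linear_simps)
  have w: "conj_transpose (transfer_fun A P S t (of_real x)) =
      mat 1 + \<i> *\<^sub>C (?P' ** ?Q ** ?T ** ?P)"
    unfolding transfer_fun_def resolvent_def[symmetric]
    by (simp add: conj_transpose_linear_simps conj_transpose_mult QR T matrix_mul_assoc)
       (simp add: vec_eq_iff cscale_def)
  have XY: "\<i> *\<^sub>C (?P ** ?P') = ?X ** S t - S t ** ?Y"
    by (simp add: matrix_mult.diff_left matrix_mult.diff_right id[symmetric] mat_mult_commute)
  have "\<i> *\<^sub>C (?P' ** ?Q ** ?T ** ?P) ** (?P' ** ?T ** ?R)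
      = ?P' ** ?Q ** ?T ** (\<i> *\<^sub>C (?P ** ?P')) ** ?T ** ?R"
    by (simp add: cscale_mult_left cscale_mult_right matrix_mul_assoc)
  also have "\<dots> = ?P' ** ?Q ** ?T ** (?X ** (S t ** ?T) ** ?R)
      - ?P' ** (?Q ** ((?T ** S t) ** ?Y)) ** ?T ** ?R"
    unfolding XY by (simp add: matrix_mult.diff_left matrix_mult.diff_right matrix_mul_assoc)
  also have "\<dots> = ?P' ** ?Q ** ?T - ?P' ** ?T ** ?R"
    by (simp add: matrix_inv_mult[OF inv] resolvent_mult[OF x] QY)
  finally show ?thesis
    unfolding w by (simp add: matrix_mult.add_left)
qed

text \<open>The term with \<open>(S\<inverse>)'\<close> supplies the summand of the transfer function that contains the resolvent,
  and the term with \<open>P'\<close> supplies its identity matrix; the intertwining relation then produces the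
  adjoint transfer function.\<close>

lemma has_vector_derivative_adjoint_mult_inv:
  fixes A :: "complex^'n^'n" and P :: "real \<Rightarrow> complex^'m^'n"
  assumes H: "\<And>k. k \<in> K \<Longrightarrow> conj_transpose (H k t) = H k t"
    and c: "\<And>k. k \<in> K \<Longrightarrow> complex_of_real (c k) \<notin> spectrum A"
    and P: "(P has_vector_derivative
         - (\<i> *\<^sub>C (\<Sum>k\<in>K. resolvent A (c k) ** P t ** H k t))) (at t within I)"
    and S: "(S has_vector_derivative
         - (\<Sum>k\<in>K. resolvent A (c k) ** P t ** H k t ** conj_transpose (P t)
                        ** resolvent (conj_transpose A) (c k))) (at t within I)"
    and inv: "invertible (S t)"
    and sa: "conj_transpose (S t) = S t"
    and id: "A ** S t - S t ** conj_transpose A = \<i> *\<^sub>C (P t ** conj_transpose (P t))"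
  shows "((\<lambda>\<tau>. conj_transpose (P \<tau>) ** matrix_inv (S \<tau>)) has_vector_derivative
      (\<Sum>k\<in>K. transformed_H A c H P S k t **
         (conj_transpose (P t) ** matrix_inv (S t) ** (\<i> *\<^sub>C resolvent A (c k))))) (at t within I)"
proof -
  define R where "R k = resolvent A (c k)" for k
  define Q where "Q k = resolvent (conj_transpose A) (c k)" for k
  define T where "T = matrix_inv (S t)"
  define B where "B = conj_transpose (P t)"
  let ?w = "\<lambda>k. transfer_fun A P S t (of_real (c k))"
  let ?P' = "- (\<i> *\<^sub>C (\<Sum>k\<in>K. R k ** P t ** H k t))"
  let ?S' = "- (\<Sum>k\<in>K. R k ** P t ** H k t ** B ** Q k)"
  have QR: "conj_transpose (R k) = Q k" if "k \<in> K" for k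
    unfolding R_def Q_def by (rule conj_transpose_resolvent[OF c[OF that]])
  have "((\<lambda>\<tau>. conj_transpose (P \<tau>) ** matrix_inv (S \<tau>)) has_vector_derivative
      (B ** (- (T ** ?S' ** T)) + conj_transpose ?P' ** T)) (at t within I)"
    using P S unfolding R_def Q_def T_def B_def
    by (intro matrix_mult.has_vector_derivative has_vector_derivative_matrix_inv inv
        bounded_linear.has_vector_derivative[OF bounded_linear_conj_transpose])
  moreover have "B ** (- (T ** ?S' ** T)) + conj_transpose ?P' ** T =
      (\<Sum>k\<in>K. transformed_H A c H P S k t ** (B ** T ** (\<i> *\<^sub>C R k)))"
  proof -
    have "B ** (- (T ** ?S' ** T)) + conj_transpose ?P' ** T =
      (\<Sum>k\<in>K. B ** T ** R k ** P t ** H k t ** B ** Q k ** T + \<i> *\<^sub>C (H k t ** B ** Q k ** T))"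
      by (simp add: matrix_mult.minus_left matrix_mult.minus_right matrix_mult.sum_left
          matrix_mult.sum_right conj_transpose_linear_simps cscale_linear_simps
          conj_transpose_mult QR H B_def[symmetric] cscale_mult_left matrix_mul_assoc sum.distrib)
        (simp add: vec_eq_iff cscale_def sum_negf)
    also have "\<dots> = (\<Sum>k\<in>K. \<i> *\<^sub>C (?w k ** H k t ** (B ** Q k ** T)))"
      unfolding transfer_fun_def resolvent_def[symmetric] R_def[symmetric] T_def[symmetric]
        B_def[symmetric]
      by (simp add: matrix_mult.diff_left cscale_mult_left cscale_linear_simps matrix_mul_assoc
          add.commute)
    also have "\<dots> = (\<Sum>k\<in>K. transformed_H A c H P S k t ** (B ** T ** (\<i> *\<^sub>C R k)))"
    proof (rule sum.cong[OF refl])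
      fix k assume "k \<in> K"
      then have "B ** Q k ** T = conj_transpose (?w k) ** (B ** T ** R k)"
        using transfer_fun_intertwining[where S = S and t = t and P = P, OF c inv sa id]
        by (simp add: B_def Q_def T_def R_def)
      then show "\<i> *\<^sub>C (?w k ** H k t ** (B ** Q k ** T))
          = transformed_H A c H P S k t ** (B ** T ** (\<i> *\<^sub>C R k))"
        by (simp add: transformed_H_def cscale_mult_right matrix_mul_assoc)
    qed
    finally show ?thesis .
  qed
  ultimately show ?thesis by (simp add: R_def B_def T_def)
qed

text \<open>As a function of \<open>\<zeta>\<^sub>k\<close> alone the exponent is \<open>B + x C\<close> with \<open>C = \<i> R\<^sub>k\<close> and \<open>B\<close> collecting the other
  summands, and \<open>B\<close> commutes with \<open>C\<close>.\<close>

lemma has_vector_derivative_transformed_psi: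
  assumes k: "k \<in> {1..r}"
    and c: "\<And>k. k \<in> {1..r} \<Longrightarrow> complex_of_real (c k) \<notin> spectrum A"
  shows "((\<lambda>x. transformed_psi A r c P S t (\<zeta>(k := x))) has_vector_derivative
      conj_transpose (P t) ** matrix_inv (S t) ** (\<i> *\<^sub>C resolvent A (c k))
        ** mat_exp (\<i> *\<^sub>C (\<Sum>j=1..r. \<zeta> j *\<^sub>R resolvent A (c j)))) (at (\<zeta> k))"
proof -
  let ?R = "\<lambda>j. resolvent A (c j)"
  let ?B = "\<i> *\<^sub>C (\<Sum>j\<in>{1..r} - {k}. \<zeta> j *\<^sub>R ?R j)" and ?C = "\<i> *\<^sub>C ?R k"
  have split: "\<i> *\<^sub>C (\<Sum>j=1..r. (\<zeta>(k := x)) j *\<^sub>R ?R j) = ?B + x *\<^sub>R ?C" for x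
  proof -
    have "(\<Sum>j\<in>{1..r} - {k}. (\<zeta>(k := x)) j *\<^sub>R ?R j) = (\<Sum>j\<in>{1..r} - {k}. \<zeta> j *\<^sub>R ?R j)"
      by (rule sum.cong) auto
    then show ?thesis
      using sum.remove[OF _ k, of "\<lambda>j. (\<zeta>(k := x)) j *\<^sub>R ?R j"]
      by (simp add: cscale_linear_simps)
  qed
  have comm: "?B ** ?C = ?C ** ?B"
  proof -
    have "(\<Sum>j\<in>{1..r} - {k}. \<zeta> j *\<^sub>R ?R j) ** ?R k = ?R k ** (\<Sum>j\<in>{1..r} - {k}. \<zeta> j *\<^sub>R ?R j)"
      by (simp add: matrix_mult.sum_left matrix_mult.sum_right matrix_mult.scaleR_left
          matrix_mult.scaleR_right resolvent_commute[OF c c[OF k]])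
    then show ?thesis by (simp only: cscale_mult_left cscale_mult_right)
  qed
  have at: "?B + \<zeta> k *\<^sub>R ?C = \<i> *\<^sub>C (\<Sum>j=1..r. \<zeta> j *\<^sub>R ?R j)"
    using split[of "\<zeta> k"] by simp
  show ?thesis
    unfolding transformed_psi_def split
    using bounded_linear.has_vector_derivative[OF matrix_mult.bounded_linear_right
        has_vector_derivative_mat_exp[OF comm, of "\<zeta> k"],
        of "conj_transpose (P t) ** matrix_inv (S t)"]
    unfolding at by (simp add: matrix_mul_assoc)
qed

theorem theorem2p1:
  fixes r :: nat
    and I :: "real set"
    and c :: "nat \<Rightarrow> real"
    and H :: "nat \<Rightarrow> real \<Rightarrow> complex^'m^'m"
    and A :: "complex^'n^'n"
    and P :: "real \<Rightarrow> complex^'m^'n"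
    and S :: "real \<Rightarrow> complex^'n^'n"
  assumes "is_interval I" and "0 \<in> I"
    and "\<And>k t. k \<in> {1..r} \<Longrightarrow> t \<in> I \<Longrightarrow> conj_transpose (H k t) = H k t"
    and "A ** S 0 - S 0 ** conj_transpose A = \<i> *\<^sub>C (P 0 ** conj_transpose (P 0))"
    and "conj_transpose (S 0) = S 0"
    and "\<And>k. k \<in> {1..r} \<Longrightarrow> complex_of_real (c k) \<notin> spectrum A"
    and "\<And>i k. i \<in> {1..r} \<Longrightarrow> k \<in> {1..r} \<Longrightarrow> i \<noteq> k \<Longrightarrow> c i \<noteq> c k"
    and "\<And>t. t \<in> I \<Longrightarrow>
      (P has_vector_derivative
         - (\<i> *\<^sub>C (\<Sum>k=1..r. resolvent A (c k) ** P t ** H k t))) (at t within I)"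
    and "\<And>t. t \<in> I \<Longrightarrow>
      (S has_vector_derivative
         - (\<Sum>k=1..r. resolvent A (c k) ** P t ** H k t ** conj_transpose (P t)
                        ** resolvent (conj_transpose A) (c k))) (at t within I)"
  shows "\<forall>t\<in>I. invertible (S t) \<longrightarrow>
    (\<forall>\<zeta>.
      (\<forall>k\<in>{1..r}. (\<lambda>x. transformed_psi A r c P S t (\<zeta>(k := x))) differentiable at (\<zeta> k)) \<and>
      ((\<lambda>\<tau>. transformed_psi A r c P S \<tau> \<zeta>) has_vector_derivative
         (\<Sum>k=1..r. transformed_H A c H P S k t **
            vector_derivative (\<lambda>x. transformed_psi A r c P S t (\<zeta>(k := x))) (at (\<zeta> k))))
        (at t within I)) \<and>
    (\<forall>k\<in>{1..r}. conj_transpose (transformed_H A c H P S k t) = transformed_H A c H P S k t)"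
proof (intro ballI impI conjI allI)
  note H = assms(3) and c = assms(6) and P = assms(8) and S = assms(9)
  fix t assume t: "t \<in> I" and inv: "invertible (S t)"
  show "conj_transpose (transformed_H A c H P S k t) = transformed_H A c H P S k t"
    if "k \<in> {1..r}" for k
    by (simp add: transformed_H_def conj_transpose_mult H[OF that t] matrix_mul_assoc)
  fix \<zeta> :: "nat \<Rightarrow> real"
  note \<zeta>_deriv = has_vector_derivative_transformed_psi[OF _ c, where t = t and \<zeta> = \<zeta> and P = P and S = S]
  show "(\<lambda>x. transformed_psi A r c P S t (\<zeta>(k := x))) differentiable at (\<zeta> k)"
    if "k \<in> {1..r}" for k
    using \<zeta>_deriv[OF that] by (rule differentiableI_vector)
  have "conj_transpose (resolvent A (c k) ** P t ** H k t ** conj_transpose (P t)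
        ** resolvent (conj_transpose A) (c k))
      = resolvent A (c k) ** P t ** H k t ** conj_transpose (P t)
        ** resolvent (conj_transpose A) (c k)" if "k \<in> {1..r}" "t \<in> I" for k t
    by (simp add: conj_transpose_mult H[OF that] matrix_mul_assoc
        conj_transpose_resolvent[OF c, OF that(1), symmetric])
  then have sa: "conj_transpose (S t) = S t"
    by (intro self_adjoint_invariant[OF assms(1,2) t S _ assms(5)])
       (simp_all add: conj_transpose_linear_simps)
  have id: "A ** S t - S t ** conj_transpose A = \<i> *\<^sub>C (P t ** conj_transpose (P t))"
    by (rule operator_identity_invariant[OF assms(1,2) t H c P S assms(4)])
  let ?E = "mat_exp (\<i> *\<^sub>C (\<Sum>j=1..r. \<zeta> j *\<^sub>R resolvent A (c j)))"
  let ?D = "\<Sum>k=1..r. transformed_H A c H P S k t **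
         (conj_transpose (P t) ** matrix_inv (S t) ** (\<i> *\<^sub>C resolvent A (c k)))"
  have D: "((\<lambda>\<tau>. conj_transpose (P \<tau>) ** matrix_inv (S \<tau>)) has_vector_derivative ?D) (at t within I)"
  proof (rule has_vector_derivative_adjoint_mult_inv)
    show "conj_transpose (H k t) = H k t" if "k \<in> {1..r}" for k
      by (rule H[OF that t])
    show "complex_of_real (c k) \<notin> spectrum A" if "k \<in> {1..r}" for k
      by (rule c[OF that])
  qed (rule P[OF t] S[OF t] inv sa id)+
  have "((\<lambda>\<tau>. transformed_psi A r c P S \<tau> \<zeta>) has_vector_derivative ?D ** ?E) (at t within I)"
    unfolding transformed_psi_def
    by (rule bounded_linear.has_vector_derivative[OF matrix_mult.bounded_linear_left[of ?E] D])
  also have "(\<Sum>k=1..r. transformed_H A c H P S k t **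
         (conj_transpose (P t) ** matrix_inv (S t) ** (\<i> *\<^sub>C resolvent A (c k)))) ** ?E
      = (\<Sum>k=1..r. transformed_H A c H P S k t **
         vector_derivative (\<lambda>x. transformed_psi A r c P S t (\<zeta>(k := x))) (at (\<zeta> k)))"
    unfolding matrix_mult.sum_left
  proof (rule sum.cong[OF refl])
    fix k assume "k \<in> {1..r}"
    from vector_derivative_at[OF \<zeta>_deriv[OF this]]
    show "transformed_H A c H P S k t **
         (conj_transpose (P t) ** matrix_inv (S t) ** (\<i> *\<^sub>C resolvent A (c k))) ** ?E
      = transformed_H A c H P S k t **
         vector_derivative (\<lambda>x. transformed_psi A r c P S t (\<zeta>(k := x))) (at (\<zeta> k))"
      by (simp only: matrix_mul_assoc)
  qed
  finally show "((\<lambda>\<tau>. transformed_psi A r c P S \<tau> \<zeta>) has_vector_derivative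
      (\<Sum>k=1..r. transformed_H A c H P S k t **
         vector_derivative (\<lambda>x. transformed_psi A r c P S t (\<zeta>(k := x))) (at (\<zeta> k))))
      (at t within I)" .
qed

end
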